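(* Let $k\ge 1$ and $m\ge 1$ be integers, and let $\mathcal{H}=(H_1,\ldots,H_m)$, where each $H_i$ is a finite nonempty $k$-uniform hypergraph on the common vertex set $V$. Let $H=\dot{\bigcup}_{j\in[m]}H_j$ be the multihypergraph that is the union of the $H_j$ counted with multiplicity. If $|H_i|\ge k\,\Delta_H\left(\bigcup H_i\right)$ for every $i\in[m]$, then $(H_1,\ldots,H_m)$ has a system of disjoint representatives (SJR).
   Context: $[m]=\{1,\ldots,m\}$. A hypergraph is identified with its set of edges (nonempty subsets of the vertex set); it is $k$-uniform if every edge has exactly $k$ vertices; $|H_i|$ is the number of edges of $H_i$, and $\bigcup H_i\subseteq V$ is the set of vertices lying in at least one edge of $H_i$. In the multiset union $\dot{\bigcup}_{j\in[m]}H_j$, an edge belonging to several of the $H_j$ appears once for each such $j$. For a multihypergraph $H$ and a vertex $v$, $deg_H(v)$ is the number of edges of $H$ (counted with multiplicity) containing $v$; for a set $S$ of vertices, $\Delta_H(S)=\max_{s\in S}deg_H(s)$. An SJR of $(H_1,\ldots,H_m)$ is a function $f:[m]\to\bigcup_{i\in[m]}H_i$ with $f(i)\in H_i$ for all $i$ and $f(i)\cap f(j)=\emptyset$ whenever $i\ne j$. *)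

theory Defs
  imports Main "HOL-Library.Multiset" "HOL-Library.FuncSet"
begin

definition hypergraph_on :: "'a set \<Rightarrow> 'a set set \<Rightarrow> bool" where
  "hypergraph_on V E \<longleftrightarrow> (\<forall>e\<in>E. e \<noteq> {} \<and> e \<subseteq> V)"

definition uniform :: "nat \<Rightarrow> 'a set set \<Rightarrow> bool" where
  "uniform k E \<longleftrightarrow> (\<forall>e\<in>E. finite e \<and> card e = k)"

(* Meant for finite H j only: mset_set of an infinite set is empty. *)
definition multi_union :: "nat \<Rightarrow> (nat \<Rightarrow> 'a set set) \<Rightarrow> 'a set multiset" where
  "multi_union m H = (\<Sum>j\<in>{1..m}. mset_set (H j))"

definition deg :: "'a set multiset \<Rightarrow> 'a \<Rightarrow> nat" where
  "deg M v = size {#e \<in># M. v \<in> e#}"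

(* Meant for finite nonempty S only: Max is unspecified otherwise. *)
definition max_deg :: "'a set multiset \<Rightarrow> 'a set \<Rightarrow> nat" where
  "max_deg M S = Max (deg M ` S)"

definition is_SJR :: "nat \<Rightarrow> (nat \<Rightarrow> 'a set set) \<Rightarrow> (nat \<Rightarrow> 'a set) \<Rightarrow> bool" where
  "is_SJR m H f \<longleftrightarrow>
     f \<in> {1..m} \<rightarrow> (\<Union>i\<in>{1..m}. H i) \<and>
     (\<forall>i\<in>{1..m}. f i \<in> H i) \<and>
     (\<forall>i\<in>{1..m}. \<forall>j\<in>{1..m}. i \<noteq> j \<longrightarrow> f i \<inter> f j = {})"

end

(*
  Give an edge of H_i the weight 1 / Delta_i, where Delta_i is the maximal degree on the union of
  H_i. Every vertex of V then has load at most 1, and every colour class H_i has weight at least k.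

  Take as "vertices" the pairs (i, e) with e in H_i, and consider real chains on the complex of sets
  of such vertices whose edges are pairwise disjoint. A Garland-type estimate bounds the weighted
  Laplacian on chains of n-element sets below by (total weight) - k n: the intersecting pairs are
  controlled by the positive semidefinite form card (e Int f). Hence, for a set I of colours, all
  cycles on sets with fewer than card I elements are boundaries. This allows one to build chains
  F_I on the colours in I, supported on card I-element sets, whose boundary is the alternating sum
  of the F_(I - {i}), starting with F_{} = 1. The boundary operator is the sum of its
  anticommuting parts belonging to single colours, and the product of these parts over all colours
  maps the chain of all colours to a nonzero constant, so that chain is nonzero on some set
  containing every colour.
*)

theory Submission
  imports Defs Complex_Main "HOL-Library.Disjoint_Sets"
begin

section \<open>Signs and the weighted boundary operator\<close>

text \<open>The simplicial orientation sign: the parity of the position that \<open>v\<close> takes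
  in \<open>T\<close>. The default 0 on infinite sets makes the rule for \<open>insert\<close> below
  hold without a finiteness assumption.\<close>

definition ins_sign :: "'v::linorder \<Rightarrow> 'v set \<Rightarrow> real" where
  "ins_sign v T = (if finite T then (-1) ^ card {u\<in>T. u < v} else 0)"

lemma ins_sign_square: "finite T \<Longrightarrow> ins_sign v T * ins_sign v T = 1"
  by (simp add: ins_sign_def flip: power_mult_distrib)

lemma ins_sign_nonzero: "finite T \<Longrightarrow> ins_sign v T \<noteq> 0"
  by (simp add: ins_sign_def)

lemma ins_sign_insert:
  assumes "u \<notin> T"
  shows "ins_sign v (insert u T) = (if u < v then - ins_sign v T else ins_sign v T)"
proof (cases "finite T")
  case True
  have "{w \<in> insert u T. w < v} = (if u < v then insert u {w\<in>T. w < v} else {w\<in>T. w < v})"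
    by auto
  with True assms show ?thesis by (simp add: ins_sign_def)
qed (simp add: ins_sign_def)

text \<open>Only the larger of \<open>u\<close> and \<open>v\<close> has a sign that notices the
  other, so exactly one of the two orders of insertion picks up a minus. This is why boundaries
  square to zero.\<close>

lemma ins_sign_swap:
  assumes "u \<notin> T" "v \<notin> T" "u \<noteq> v"
  shows "ins_sign v T * ins_sign u (insert v T) = - (ins_sign u T * ins_sign v (insert u T))"
  using assms by (cases u v rule: linorder_cases) (auto simp: ins_sign_insert)

text \<open>The same single sign change, in the form needed when a coboundary followed by a boundary
  replaces \<open>u\<close> by \<open>v\<close>.\<close>

lemma ins_sign_exchange:
  assumes "u \<notin> T" "v \<notin> T" "u \<noteq> v"
  shows "ins_sign v (insert u T) * ins_sign u (insert v T) = - (ins_sign u T * ins_sign v T)"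
  using assms by (cases u v rule: linorder_cases) (auto simp: ins_sign_insert)

text \<open>Passing from a chain \<open>f\<close> to \<open>\<lambda>S. prod a S * f S\<close> turns this into the usual simplicial boundary; in
  this normalisation it is adjoint to the unweighted coboundary for the inner product with
  weights \<open>prod a S\<close>.\<close>

definition bd :: "('v::linorder \<Rightarrow> real) \<Rightarrow> 'v set \<Rightarrow> ('v set \<Rightarrow> real) \<Rightarrow> 'v set \<Rightarrow> real" where
  "bd a A f T = (\<Sum>v\<in>A - T. a v * ins_sign v T * f (insert v T))"

lemma bd_zero [simp]: "bd a A (\<lambda>_. 0) = (\<lambda>_. 0)"
  by (simp add: bd_def fun_eq_iff)

lemma bd_uminus: "bd a A (\<lambda>T. - f T) = (\<lambda>T. - bd a A f T)"
  by (simp add: bd_def fun_eq_iff sum_negf)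

lemma bd_diff: "bd a A (\<lambda>T. f T - g T) = (\<lambda>T. bd a A f T - bd a A g T)"
  by (simp add: bd_def fun_eq_iff sum_subtractf right_diff_distrib)

lemma bd_sum: "bd a A (\<lambda>T. \<Sum>i\<in>I. c i * f i T) = (\<lambda>T. \<Sum>i\<in>I. c i * bd a A (f i) T)"
proof
  fix T
  have "bd a A (\<lambda>T. \<Sum>i\<in>I. c i * f i T) T =
      (\<Sum>v\<in>A - T. \<Sum>i\<in>I. c i * (a v * ins_sign v T * f i (insert v T)))"
    by (simp add: bd_def sum_distrib_left mult_ac)
  also have "\<dots> = (\<Sum>i\<in>I. c i * bd a A (f i) T)"
    by (subst sum.swap) (simp add: bd_def sum_distrib_left)
  finally show "bd a A (\<lambda>T. \<Sum>i\<in>I. c i * f i T) T = (\<Sum>i\<in>I. c i * bd a A (f i) T)" .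
qed

text \<open>Both composites insert the same pairs in opposite orders, hence with opposite signs. The
  ground sets may overlap: \<open>A = B\<close> yields \<open>bd_bd\<close>, and different colour
  classes yield anticommuting operators.\<close>

lemma bd_anticommute:
  assumes "finite A" "finite B"
  shows "bd a A (bd a B f) = (\<lambda>T. - bd a B (bd a A f) T)"
proof
  fix T
  have "bd a A (bd a B f) T = (\<Sum>v\<in>A - T. \<Sum>u\<in>B - insert v T.
      a v * a u * (ins_sign v T * ins_sign u (insert v T)) * f (insert u (insert v T)))"
    by (simp add: bd_def sum_distrib_left mult_ac)
  \<comment> \<open>Zeros on the diagonal make the index set a rectangle, so that the sums can be
    exchanged.\<close>
  also have "\<dots> = (\<Sum>v\<in>A - T. \<Sum>u\<in>B - T. if u = v then 0 else
      a v * a u * (ins_sign v T * ins_sign u (insert v T)) * f (insert u (insert v T)))"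
    using assms by (intro sum.cong sum.mono_neutral_cong_left) auto
  also have "\<dots> = (\<Sum>u\<in>B - T. \<Sum>v\<in>A - T. if u = v then 0 else
      a v * a u * (ins_sign v T * ins_sign u (insert v T)) * f (insert u (insert v T)))"
    by (rule sum.swap)
  also have "\<dots> = (\<Sum>u\<in>B - T. \<Sum>v\<in>A - T. if v = u then 0 else
      - (a u * a v * (ins_sign u T * ins_sign v (insert u T)) * f (insert v (insert u T))))"
  proof (intro sum.cong refl)
    fix u v assume "u \<in> B - T" "v \<in> A - T"
    then have "ins_sign v T * ins_sign u (insert v T) = - (ins_sign u T * ins_sign v (insert u T))"
      if "v \<noteq> u" using that ins_sign_swap[of u T v] by auto
    then show "(if u = v then 0 else
        a v * a u * (ins_sign v T * ins_sign u (insert v T)) * f (insert u (insert v T))) =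
      (if v = u then 0 else
        - (a u * a v * (ins_sign u T * ins_sign v (insert u T)) * f (insert v (insert u T))))"
      by (simp add: insert_commute[of u v T])
  qed
  also have "\<dots> = (\<Sum>u\<in>B - T. \<Sum>v\<in>A - insert u T.
      - (a u * a v * (ins_sign u T * ins_sign v (insert u T)) * f (insert v (insert u T))))"
    using assms by (intro sum.cong sum.mono_neutral_cong_right) auto
  also have "\<dots> = - bd a B (bd a A f) T"
    by (simp add: bd_def sum_distrib_left mult_ac sum_negf)
  finally show "bd a A (bd a B f) T = - bd a B (bd a A f) T" .
qed

lemma bd_bd: "finite A \<Longrightarrow> bd a A (bd a A f) = (\<lambda>_. 0)"
  using bd_anticommute[of A A a f] by (auto simp: fun_eq_iff)

lemma bd_restrict:
  assumes "finite W" "U \<subseteq> W" "\<And>T. f T \<noteq> 0 \<Longrightarrow> T \<subseteq> U"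
  shows "bd a W f = bd a U f"
proof
  fix T
  show "bd a W f T = bd a U f T"
    unfolding bd_def using assms by (intro sum.mono_neutral_right) auto
qed

section \<open>Orthogonal projection for a weighted inner product\<close>

text \<open>Gram-Schmidt, without assuming the \<open>b r\<close> independent. The vector
  \<open>z\<close> is generalised because the induction hypothesis is applied both to
  \<open>z\<close> and to \<open>b x\<close>.\<close>

lemma exists_projection:
  fixes w z :: "'i \<Rightarrow> real" and b :: "'r \<Rightarrow> 'i \<Rightarrow> real"
  assumes "finite R" "finite J" and w: "\<And>s. s \<in> J \<Longrightarrow> w s > 0"
  shows "\<exists>c. \<forall>r\<in>R. (\<Sum>s\<in>J. w s * (z s - (\<Sum>q\<in>R. c q * b q s)) * b r s) = 0"
  using assms(1)
proof (induction R arbitrary: z rule: finite_induct)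
  case empty
  then show ?case by simp
next
  case (insert x R)
  define ip where "ip f g = (\<Sum>s\<in>J. w s * f s * g s)" for f g :: "'i \<Rightarrow> real"
  have ip_comm: "ip f g = ip g f" for f g by (simp add: ip_def mult_ac)
  have ip_diff: "ip (\<lambda>s. f s - e * g s) h = ip f h - e * ip g h" for f g h e
    by (simp add: ip_def sum_subtractf sum_distrib_left algebra_simps)
  have ip_sum: "ip (\<lambda>s. \<Sum>q\<in>R. d q * b q s) h = (\<Sum>q\<in>R. d q * ip (b q) h)" for d h
    unfolding ip_def sum_distrib_left sum_distrib_right by (subst sum.swap) (simp add: mult_ac)
  obtain c where c: "\<And>r. r \<in> R \<Longrightarrow> ip (\<lambda>s. z s - (\<Sum>q\<in>R. c q * b q s)) (b r) = 0"
    using insert.IH[of z] by (auto simp: ip_def)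
  obtain d where d: "\<And>r. r \<in> R \<Longrightarrow> ip (\<lambda>s. b x s - (\<Sum>q\<in>R. d q * b q s)) (b r) = 0"
    using insert.IH[of "b x"] by (auto simp: ip_def)
  define y where "y s = z s - (\<Sum>q\<in>R. c q * b q s)" for s
  define b' where "b' s = b x s - (\<Sum>q\<in>R. d q * b q s)" for s
  \<comment> \<open>If \<open>b'\<close> has norm zero, the quotient is 0 by the convention on
    division; \<open>b'\<close> then vanishes on \<open>J\<close>, so orthogonality to it is
    automatic.\<close>
  define t where "t = ip y b' / ip b' b'"
  have yR: "ip y (b r) = 0" and b'R: "ip b' (b r) = 0" if "r \<in> R" for r
    using c[OF that] d[OF that] by (simp_all add: y_def[abs_def] b'_def[abs_def])
  have bx: "ip h (b x) = ip h b' + (\<Sum>q\<in>R. d q * ip h (b q))" for h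
  proof -
    have "ip b' h = ip (b x) h - ip (\<lambda>s. \<Sum>q\<in>R. d q * b q s) h"
      using ip_diff[of "b x" 1 "\<lambda>s. \<Sum>q\<in>R. d q * b q s" h] by (simp add: b'_def [abs_def])
    then show ?thesis by (simp add: ip_sum ip_comm[of h])
  qed
  have t: "ip y b' - t * ip b' b' = 0"
  proof (cases "ip b' b' = 0")
    case True
    then have "\<forall>s\<in>J. w s * b' s * b' s = 0"
      unfolding ip_def using w by (subst (asm) sum_nonneg_eq_0_iff) (auto simp: assms(2) mult.assoc less_imp_le)
    then have "\<forall>s\<in>J. b' s = 0" using w by fastforce
    then show ?thesis by (simp add: ip_def)
  qed (simp add: t_def)
  \<comment> \<open>The coefficients that result from expanding \<open>y - t * b'\<close> in the
    original vectors.\<close>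
  define e where "e q = (if q = x then t else c q - t * d q)" for q
  have res: "z s - (\<Sum>q\<in>insert x R. e q * b q s) = y s - t * b' s" for s
  proof -
    have "(\<Sum>q\<in>R. e q * b q s) = (\<Sum>q\<in>R. c q * b q s) - t * (\<Sum>q\<in>R. d q * b q s)"
      unfolding sum_distrib_left sum_subtractf[symmetric] using insert.hyps
      by (intro sum.cong) (auto simp: e_def algebra_simps)
    then show ?thesis using insert.hyps by (simp add: e_def y_def b'_def algebra_simps)
  qed
  have "ip (\<lambda>s. y s - t * b' s) (b r) = 0" if "r \<in> insert x R" for r
  proof (cases "r = x")
    case True
    have "ip y (b x) = ip y b'" "ip b' (b x) = ip b' b'"
      by (simp_all add: bx[of y] bx[of b'] yR b'R)
    then show ?thesis using t True by (simp add: ip_diff)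
  next
    case False
    then show ?thesis using that by (simp add: ip_diff yR b'R)
  qed
  then show ?case
    by (intro exI[of _ e]) (auto simp only: res ip_def)
qed

section \<open>Faces and links of the complex of disjoint edges\<close>

text \<open>The faces with \<open>n\<close> vertices. Edges are attached to vertices through
  \<open>E\<close>, so that one edge may occur under several colours.\<close>

definition indep :: "('v \<Rightarrow> 'a set) \<Rightarrow> 'v set \<Rightarrow> nat \<Rightarrow> 'v set set" where
  "indep E W n = {S. S \<subseteq> W \<and> card S = n \<and> disjoint_family_on E S}"

text \<open>When all edges are nonempty, this excludes the members of \<open>S\<close>
  automatically.\<close>

definition link :: "('v \<Rightarrow> 'a set) \<Rightarrow> 'v set \<Rightarrow> 'v set \<Rightarrow> 'v set" where
  "link E W S = {v\<in>W. \<forall>u\<in>S. E u \<inter> E v = {}}"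

lemma finite_indep: "finite W \<Longrightarrow> finite (indep E W n)"
  by (rule finite_subset[of _ "Pow W"]) (auto simp: indep_def)

lemma indep_finite: "finite W \<Longrightarrow> S \<in> indep E W n \<Longrightarrow> finite S"
  by (auto simp: indep_def finite_subset)

lemma link_subset_Diff: "(\<And>v. v \<in> W \<Longrightarrow> E v \<noteq> {}) \<Longrightarrow> link E W S \<subseteq> W - S"
  unfolding link_def by blast

lemma insert_indep_iff:
  assumes "finite W" "v \<in> W" "v \<notin> S" "E v \<noteq> {}"
  shows "insert v S \<in> indep E W (Suc n) \<longleftrightarrow> S \<in> indep E W n \<and> v \<in> link E W S"
proof (cases "S \<subseteq> W")
  case True
  then have "finite S" using assms(1) finite_subset by blast
  then have "card (insert v S) = Suc (card S)" using assms(3) by simp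
  moreover have "disjoint_family_on E (insert v S) \<longleftrightarrow> disjoint_family_on E S \<and> (\<forall>u\<in>S. E u \<inter> E v = {})"
    using disjoint_family_on_insert[OF assms(3), of E] by blast
  ultimately show ?thesis using True assms(2)
    unfolding indep_def link_def by simp
qed (auto simp: indep_def)

lemma remove_indep:
  assumes "finite W" "S \<in> indep E W n" "u \<in> S" 
  shows "S - {u} \<in> indep E W (n - 1)" "u \<in> link E W (S - {u})" "n > 0"
proof -
  have "finite S" using assms indep_finite by blast
  with assms show "S - {u} \<in> indep E W (n - 1)" "u \<in> link E W (S - {u})" "n > 0"
    by (auto simp: indep_def link_def disjoint_family_on_def card_gt_0_iff)
qed


section \<open>Quadratic forms and weights in links\<close>

text \<open>The difference between the positive semidefinite form given by intersection sizes and the 0-1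
  form of intersecting pairs.\<close>

definition excess :: "('v \<Rightarrow> 'a set) \<Rightarrow> 'v \<Rightarrow> 'v \<Rightarrow> real" where
  "excess E u v = real (card (E u \<inter> E v)) - of_bool (E u \<inter> E v \<noteq> {})"

lemma excess_commute: "excess E u v = excess E v u"
  by (simp add: excess_def Int_commute)

lemma excess_nonneg: "finite (E u) \<Longrightarrow> excess E u v \<ge> 0"
  by (auto simp: excess_def Suc_le_eq card_gt_0_iff)

text \<open>Intersection sizes form the Gram matrix of the indicator vectors of the edges, so the
  form is a sum of squares over the points.\<close>

lemma intersection_form_nonneg:
  fixes x :: "'v \<Rightarrow> real"
  assumes "finite L" "\<And>v. v \<in> L \<Longrightarrow> finite (E v)"
  shows "(\<Sum>u\<in>L. \<Sum>v\<in>L. real (card (E u \<inter> E v)) * (x u * x v)) \<ge> 0"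
proof -
  define P where "P = (\<Union>v\<in>L. E v)"
  have fP: "finite P" using assms by (simp add: P_def)
  have "real (card (E u \<inter> E v)) = (\<Sum>p\<in>P. of_bool (p \<in> E u) * of_bool (p \<in> E v))"
    if "u \<in> L" "v \<in> L" for u v
  proof -
    have "(\<Sum>p\<in>P. of_bool (p \<in> E u) * of_bool (p \<in> E v)) = (\<Sum>p\<in>E u \<inter> E v. 1 :: real)"
      using that fP by (intro sum.mono_neutral_cong_right) (auto simp: P_def)
    then show ?thesis by simp
  qed
  then have "(\<Sum>u\<in>L. \<Sum>v\<in>L. real (card (E u \<inter> E v)) * (x u * x v)) =
      (\<Sum>u\<in>L. \<Sum>v\<in>L. \<Sum>p\<in>P. (of_bool (p \<in> E u) * x u) * (of_bool (p \<in> E v) * x v))"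
    by (intro sum.cong refl) (simp add: sum_distrib_right sum_distrib_left mult_ac)
  also have "\<dots> = (\<Sum>u\<in>L. \<Sum>p\<in>P. \<Sum>v\<in>L. (of_bool (p \<in> E u) * x u) * (of_bool (p \<in> E v) * x v))"
    by (intro sum.cong refl sum.swap)
  also have "\<dots> = (\<Sum>p\<in>P. \<Sum>u\<in>L. \<Sum>v\<in>L. (of_bool (p \<in> E u) * x u) * (of_bool (p \<in> E v) * x v))"
    by (rule sum.swap)
  also have "\<dots> = (\<Sum>p\<in>P. (\<Sum>u\<in>L. of_bool (p \<in> E u) * x u)\<^sup>2)"
    by (simp only: power2_eq_square sum_product)
  also have "\<dots> \<ge> 0" by (intro sum_nonneg) simp
  finally show ?thesis .
qed

text \<open>The indicator of disjointness equals 1 minus the intersection size plus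
  \<open>excess\<close>. The constant form vanishes by \<open>zero\<close>, the intersection form is
  nonnegative, and the excess form, with its nonnegative symmetric coefficients, is bounded through
  its row sums.\<close>

lemma disjoint_form_bound:
  fixes a y :: "'v \<Rightarrow> real"
  assumes "finite L" and fin: "\<And>v. v \<in> L \<Longrightarrow> finite (E v)"
    and a: "\<And>v. v \<in> L \<Longrightarrow> a v \<ge> 0"
    and zero: "(\<Sum>v\<in>L. a v * y v) = 0"
  shows "(\<Sum>u\<in>L. \<Sum>v\<in>L. of_bool (E u \<inter> E v = {}) * (a u * y u * (a v * y v)))
    \<le> (\<Sum>u\<in>L. a u * (y u)\<^sup>2 * (\<Sum>v\<in>L. a v * excess E u v))"
proof -
  define x where "x v = a v * y v" for v
  have "(\<Sum>u\<in>L. \<Sum>v\<in>L. of_bool (E u \<inter> E v = {}) * (x u * x v)) =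
      (\<Sum>u\<in>L. \<Sum>v\<in>L. x u * x v) - (\<Sum>u\<in>L. \<Sum>v\<in>L. real (card (E u \<inter> E v)) * (x u * x v))
      + (\<Sum>u\<in>L. \<Sum>v\<in>L. excess E u v * (x u * x v))"
    unfolding sum_subtractf[symmetric] sum.distrib[symmetric]
    by (intro sum.cong refl) (simp add: excess_def algebra_simps)
  also have "(\<Sum>u\<in>L. \<Sum>v\<in>L. x u * x v) = 0"
    using zero by (simp add: x_def flip: sum_product)
  also have "0 - (\<Sum>u\<in>L. \<Sum>v\<in>L. real (card (E u \<inter> E v)) * (x u * x v)) \<le> 0"
    using intersection_form_nonneg[of L E x] assms(1) fin by simp
  also have "(\<Sum>u\<in>L. \<Sum>v\<in>L. excess E u v * (x u * x v)) \<le>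
      (\<Sum>u\<in>L. \<Sum>v\<in>L. excess E u v * (a u * a v) * (((y u)\<^sup>2 + (y v)\<^sup>2) / 2))"
  proof (intro sum_mono)
    fix u v assume "u \<in> L" "v \<in> L"
    then have "excess E u v * (a u * a v) \<ge> 0" using fin a excess_nonneg[of E u v] by simp
    moreover have "y u * y v \<le> ((y u)\<^sup>2 + (y v)\<^sup>2) / 2"
      using sum_squares_bound[of "y u" "y v"] by simp
    ultimately show "excess E u v * (x u * x v) \<le>
        excess E u v * (a u * a v) * (((y u)\<^sup>2 + (y v)\<^sup>2) / 2)"
      using mult_left_mono[of "y u * y v" "((y u)\<^sup>2 + (y v)\<^sup>2) / 2" "excess E u v * (a u * a v)"]
      by (simp add: x_def mult_ac)
  qed
  also have "\<dots> = (\<Sum>u\<in>L. \<Sum>v\<in>L. excess E u v * (a u * a v) * ((y u)\<^sup>2 / 2)) +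
      (\<Sum>u\<in>L. \<Sum>v\<in>L. excess E u v * (a u * a v) * ((y v)\<^sup>2 / 2))"
    unfolding sum.distrib[symmetric]
    by (intro sum.cong refl) (simp add: algebra_simps add_divide_distrib)
  also have "(\<Sum>u\<in>L. \<Sum>v\<in>L. excess E u v * (a u * a v) * ((y v)\<^sup>2 / 2)) =
      (\<Sum>u\<in>L. \<Sum>v\<in>L. excess E u v * (a u * a v) * ((y u)\<^sup>2 / 2))"
    by (subst sum.swap) (simp add: excess_commute mult_ac)
  also have "0 + ((\<Sum>u\<in>L. \<Sum>v\<in>L. excess E u v * (a u * a v) * ((y u)\<^sup>2 / 2)) +
      (\<Sum>u\<in>L. \<Sum>v\<in>L. excess E u v * (a u * a v) * ((y u)\<^sup>2 / 2))) =
      (\<Sum>u\<in>L. a u * (y u)\<^sup>2 * (\<Sum>v\<in>L. a v * excess E u v))"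
    unfolding sum.distrib[symmetric] sum_distrib_left add_0
    by (intro sum.cong refl) (simp add: mult_ac)
  finally show ?thesis by (simp add: x_def)
qed

text \<open>Bounds below the coefficient that the square of \<open>f S\<close> receives in the
  Garland estimate. A vertex lost from the link has an edge meeting an edge of \<open>S\<close>, and
  each of the \<open>k * n\<close> points of those edges carries load at most 1.\<close>

lemma link_weight_bound:
  fixes a :: "'v \<Rightarrow> real"
  assumes finW: "finite W" and S: "S \<in> indep E W n"
    and E: "\<And>v. v \<in> W \<Longrightarrow> finite (E v) \<and> card (E v) = k"
    and a: "\<And>v. v \<in> W \<Longrightarrow> a v > 0"
    and load: "\<And>p. (\<Sum>v | v \<in> W \<and> p \<in> E v. a v) \<le> 1"
  shows "(\<Sum>v\<in>W. a v) - real (k * n) \<le>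
    (\<Sum>v\<in>link E W S. a v) - (\<Sum>u\<in>S. \<Sum>v\<in>link E W (S - {u}). a v * excess E u v)"
proof -
  have finS: "finite S" and SW: "S \<subseteq> W" and cS: "card S = n"
    using S finW by (auto simp: indep_def finite_subset)
  have point: "1 - (\<Sum>u\<in>S. real (card (E u \<inter> E v))) \<le>
      of_bool (v \<in> link E W S) - (\<Sum>u\<in>S. of_bool (v \<in> link E W (S - {u})) * excess E u v)"
    if "v \<in> W" for v
  proof (cases "v \<in> link E W S")
    case True
    then show ?thesis by (simp add: link_def excess_def)
  next
    case False
    with that obtain u0 where u0: "u0 \<in> S" "E u0 \<inter> E v \<noteq> {}" by (auto simp: link_def)
    \<comment> \<open>\<open>u0\<close> keeps \<open>v\<close> out of the link of
      \<open>S - {u}\<close> for every other \<open>u\<close>. Only the term of \<open>u0\<close>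
      can survive, and the 1 subtracted in \<open>excess\<close> pays for the missing
      vertex.\<close>
    have "of_bool (v \<in> link E W (S - {u})) * excess E u v \<le>
        real (card (E u \<inter> E v)) - of_bool (u = u0)" if "u \<in> S" for u
    proof (cases "u = u0")
      case True
      have "finite (E u0)" using u0 E SW by blast
      with True u0 show ?thesis
        using excess_nonneg[of E u0 v] by (auto simp: excess_def of_bool_def)
    next
      case False
      then have "v \<notin> link E W (S - {u})" using u0 by (auto simp: link_def)
      with False show ?thesis by simp
    qed
    then have "(\<Sum>u\<in>S. of_bool (v \<in> link E W (S - {u})) * excess E u v) \<le>
        (\<Sum>u\<in>S. real (card (E u \<inter> E v)) - of_bool (u = u0))"
      by (rule sum_mono)
    also have "\<dots> = (\<Sum>u\<in>S. real (card (E u \<inter> E v))) - 1"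
      using u0 finS by (simp add: sum_subtractf of_bool_def)
    finally show ?thesis using False by simp
  qed
  have "(\<Sum>v\<in>W. a v * (\<Sum>u\<in>S. real (card (E u \<inter> E v)))) \<le> real (k * n)"
  proof -
    have "real (card (E u \<inter> E v)) = (\<Sum>p\<in>E u. of_bool (p \<in> E v))" if "u \<in> S" for u v
    proof -
      have "finite (E u)" using that SW E by blast
      then show ?thesis by (simp add: of_bool_def sum.If_cases Int_def)
    qed
    then have "(\<Sum>v\<in>W. a v * (\<Sum>u\<in>S. real (card (E u \<inter> E v)))) =
        (\<Sum>v\<in>W. \<Sum>u\<in>S. \<Sum>p\<in>E u. a v * of_bool (p \<in> E v))"
      by (simp add: sum_distrib_left)
    also have "\<dots> = (\<Sum>u\<in>S. \<Sum>v\<in>W. \<Sum>p\<in>E u. a v * of_bool (p \<in> E v))"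
      by (rule sum.swap)
    also have "\<dots> = (\<Sum>u\<in>S. \<Sum>p\<in>E u. \<Sum>v\<in>W. a v * of_bool (p \<in> E v))"
      by (intro sum.cong refl sum.swap)
    also have "\<dots> = (\<Sum>u\<in>S. \<Sum>p\<in>E u. \<Sum>v | v \<in> W \<and> p \<in> E v. a v)"
      using finW by (intro sum.cong refl sum.mono_neutral_cong_right) auto
    also have "\<dots> \<le> (\<Sum>u\<in>S. \<Sum>p\<in>E u. 1)"
      by (intro sum_mono load)
    also have "\<dots> = (\<Sum>u\<in>S. real k)"
      using E SW by (intro sum.cong refl) auto
    finally show ?thesis by (simp add: cS mult.commute)
  qed
  then have "(\<Sum>v\<in>W. a v) - real (k * n) \<le>
      (\<Sum>v\<in>W. a v * (1 - (\<Sum>u\<in>S. real (card (E u \<inter> E v)))))"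
    by (simp add: right_diff_distrib sum_subtractf)
  also have "\<dots> \<le> (\<Sum>v\<in>W. a v * (of_bool (v \<in> link E W S) -
      (\<Sum>u\<in>S. of_bool (v \<in> link E W (S - {u})) * excess E u v)))"
    using point a by (intro sum_mono mult_left_mono) (auto intro: less_imp_le)
  also have "\<dots> = (\<Sum>v\<in>W. a v * of_bool (v \<in> link E W S)) -
      (\<Sum>v\<in>W. \<Sum>u\<in>S. a v * (of_bool (v \<in> link E W (S - {u})) * excess E u v))"
    by (simp add: right_diff_distrib sum_subtractf sum_distrib_left)
  also have "(\<Sum>v\<in>W. \<Sum>u\<in>S. a v * (of_bool (v \<in> link E W (S - {u})) * excess E u v)) =
      (\<Sum>u\<in>S. \<Sum>v\<in>W. a v * (of_bool (v \<in> link E W (S - {u})) * excess E u v))"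
    by (rule sum.swap)
  also have "\<dots> = (\<Sum>u\<in>S. \<Sum>v\<in>link E W (S - {u}). a v * excess E u v)"
    using finW by (intro sum.cong refl sum.mono_neutral_cong_right) (auto simp: link_def)
  also have "(\<Sum>v\<in>W. a v * of_bool (v \<in> link E W S)) = (\<Sum>v\<in>link E W S. a v)"
    using finW by (intro sum.mono_neutral_cong_right) (auto simp: link_def)
  finally show ?thesis .
qed

section \<open>Garland-type estimate and filling of cycles\<close>

lemma sum_of_bool_eq:
  fixes y :: "'b \<Rightarrow> real"
  assumes "finite A"
  shows "(\<Sum>R\<in>A. y R * of_bool (T = R)) = (if T \<in> A then y T else 0)"
proof -
  have "(\<Sum>R\<in>A. y R * of_bool (T = R)) = (\<Sum>R\<in>A. if T = R then y R else 0)"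
    by (intro sum.cong) auto
  then show ?thesis using assms by simp
qed

text \<open>Double counting: a face with a marked vertex is the same as a facet with a vertex of its
  link.\<close>

lemma sum_over_facets:
  fixes g :: "'v set \<Rightarrow> 'v \<Rightarrow> real"
  assumes "finite W" "\<And>v. v \<in> W \<Longrightarrow> E v \<noteq> {}"
  shows "(\<Sum>S\<in>indep E W (Suc n). \<Sum>u\<in>S. g (S - {u}) u) = (\<Sum>T\<in>indep E W n. \<Sum>u\<in>link E W T. g T u)"
proof -
  have 1: "\<forall>S\<in>indep E W m. finite S" for m using assms(1) indep_finite by blast
  have 2: "\<forall>T\<in>indep E W m. finite (link E W T)" for m using assms(1) by (simp add: link_def)
  have "(\<Sum>S\<in>indep E W (Suc n). \<Sum>u\<in>S. g (S - {u}) u) =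
      (\<Sum>(S, u)\<in>Sigma (indep E W (Suc n)) (\<lambda>S. S). g (S - {u}) u)"
    using sum.Sigma[OF finite_indep[OF assms(1), of E "Suc n"] 1[of "Suc n"], of "\<lambda>S u. g (S - {u}) u"] .
  also have "\<dots> = (\<Sum>(T, u)\<in>Sigma (indep E W n) (link E W). g T u)"
  proof (rule sum.reindex_bij_witness[of _ "\<lambda>(T, u). (insert u T, u)" "\<lambda>(S, u). (S - {u}, u)"])
    fix x assume x: "x \<in> Sigma (indep E W (Suc n)) (\<lambda>S. S)"
    obtain S u where xSu: "x = (S, u)" by (cases x)
    show "(case case x of (S, u) \<Rightarrow> (S - {u}, u) of (T, u) \<Rightarrow> (insert u T, u)) = x"
      using x by (auto simp: insert_absorb)
    show "(case x of (S, u) \<Rightarrow> (S - {u}, u)) \<in> Sigma (indep E W n) (link E W)"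
      using x remove_indep[OF assms(1), of S E "Suc n" u] by (simp add: xSu)
    show "(case case x of (S, u) \<Rightarrow> (S - {u}, u) of (T, u) \<Rightarrow> g T u) = (case x of (S, u) \<Rightarrow> g (S - {u}) u)"
      by (simp add: xSu)
  next
    fix x assume x: "x \<in> Sigma (indep E W n) (link E W)"
    obtain T u where xTu: "x = (T, u)" by (cases x)
    have u: "u \<in> W" "u \<notin> T"
      using x link_subset_Diff[of W E T] assms(2) by (auto simp: xTu)
    show "(case case x of (T, u) \<Rightarrow> (insert u T, u) of (S, u) \<Rightarrow> (S - {u}, u)) = x"
      using u by (simp add: xTu)
    show "(case x of (T, u) \<Rightarrow> (insert u T, u)) \<in> Sigma (indep E W (Suc n)) (\<lambda>S. S)"
      using x u assms insert_indep_iff[of W u T E n] by (simp add: xTu)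
  qed
  also have "\<dots> = (\<Sum>T\<in>indep E W n. \<Sum>u\<in>link E W T. g T u)"
    using sum.Sigma[OF finite_indep[OF assms(1), of E n] 2[of n], of g] by simp
  finally show ?thesis .
qed

text \<open>For a cycle, the values on the link of a facet sum to zero, so the pairs of disjoint edges in the
  link can be traded for the intersecting ones.\<close>

lemma cross_term_bound:
  fixes a :: "'v::linorder \<Rightarrow> real"
  assumes finW: "finite W"
    and E: "\<And>v. v \<in> W \<Longrightarrow> finite (E v) \<and> E v \<noteq> {}"
    and a: "\<And>v. v \<in> W \<Longrightarrow> a v > 0"
    and supp: "\<And>S. f S \<noteq> 0 \<Longrightarrow> S \<in> indep E W n"
    and cycle: "bd a W f = (\<lambda>_. 0)"
  shows "(\<Sum>S\<in>indep E W n. \<Sum>u\<in>S. prod a S * (\<Sum>v\<in>link E W S. a v *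
        (ins_sign u (S - {u}) * f S * (ins_sign v (S - {u}) * f (insert v (S - {u}))))))
    \<le> (\<Sum>S\<in>indep E W n. prod a S * (f S)\<^sup>2 * (\<Sum>u\<in>S. \<Sum>v\<in>link E W (S - {u}). a v * excess E u v))"
    (is "?L \<le> ?R")
proof (cases n)
  case 0
  then have "indep E W n = {{}}"
    using finW by (auto simp: indep_def disjoint_family_on_def dest: finite_subset)
  then show ?thesis by simp
next
  case (Suc n')
  \<comment> \<open>\<open>psi T\<close> reads the chain around \<open>T\<close> as a function on
    the link of \<open>T\<close>, with the signs of the boundary absorbed.\<close>
  define psi where "psi T u = ins_sign u T * f (insert u T)" for T u
  have finL: "finite (link E W T)" for T using finW by (simp add: link_def)
  have sub: "link E W T \<subseteq> W - T" for T using E by (intro link_subset_Diff) simp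
  have fin: "finite S" if "S \<in> indep E W m" for S m using indep_finite[OF finW that] .
  have "?L = (\<Sum>S\<in>indep E W n. \<Sum>u\<in>S. prod a (S - {u}) * a u *
      (\<Sum>v\<in>link E W (insert u (S - {u})). a v * (psi (S - {u}) u * psi (S - {u}) v)))"
    using fin by (intro sum.cong refl) (simp add: insert_absorb psi_def prod.remove mult_ac)
  also have "\<dots> = (\<Sum>T\<in>indep E W n'. \<Sum>u\<in>link E W T. prod a T * a u *
      (\<Sum>v\<in>link E W (insert u T). a v * (psi T u * psi T v)))"
    using sum_over_facets[OF finW, of E "\<lambda>T u. prod a T * a u *
      (\<Sum>v\<in>link E W (insert u T). a v * (psi T u * psi T v))" n'] E by (simp add: Suc)
  also have "\<dots> = (\<Sum>T\<in>indep E W n'. prod a T * (\<Sum>u\<in>link E W T. \<Sum>v\<in>link E W T.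
      of_bool (E u \<inter> E v = {}) * (a u * psi T u * (a v * psi T v))))"
  proof (intro sum.cong refl)
    fix T
    have *: "a u * (\<Sum>v\<in>link E W (insert u T). a v * (psi T u * psi T v)) =
        (\<Sum>v\<in>link E W T. of_bool (E u \<inter> E v = {}) * (a u * psi T u * (a v * psi T v)))" for u
      unfolding sum_distrib_left using finL by (intro sum.mono_neutral_cong_left) (auto simp: link_def)
    show "(\<Sum>u\<in>link E W T. prod a T * a u *
        (\<Sum>v\<in>link E W (insert u T). a v * (psi T u * psi T v))) =
      prod a T * (\<Sum>u\<in>link E W T. \<Sum>v\<in>link E W T.
        of_bool (E u \<inter> E v = {}) * (a u * psi T u * (a v * psi T v)))"
      by (simp only: mult.assoc[of "prod a T"] * sum_distrib_left[of "prod a T", symmetric])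
  qed
  also have "\<dots> \<le> (\<Sum>T\<in>indep E W n'. prod a T * (\<Sum>u\<in>link E W T. a u * (psi T u)\<^sup>2 *
      (\<Sum>v\<in>link E W T. a v * excess E u v)))"
  proof (rule sum_mono, rule mult_left_mono, rule disjoint_form_bound[OF finL])
    fix T assume T: "T \<in> indep E W n'"
    then show "prod a T \<ge> 0"
      using a by (intro prod_nonneg) (auto simp: indep_def intro: less_imp_le)
    show "finite (E v)" "a v \<ge> 0" if "v \<in> link E W T" for v
      using that E a by (auto simp: link_def intro: less_imp_le)
    \<comment> \<open>Off the link, \<open>insert v T\<close> is no face and \<open>f\<close>
      vanishes on it, so the sum over the link is the whole boundary at \<open>T\<close>.\<close>
    have "(\<Sum>v\<in>link E W T. a v * psi T v) = (\<Sum>v\<in>W - T. a v * psi T v)"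
    proof (intro sum.mono_neutral_left ballI)
      show "finite (W - T)" using finW by simp
      show "link E W T \<subseteq> W - T" by (rule sub)
      fix v assume v: "v \<in> W - T - link E W T"
      then have "insert v T \<notin> indep E W n"
        using insert_indep_iff[OF finW, of v T E n'] E by (auto simp: Suc)
      then have "f (insert v T) = 0" using supp by blast
      then show "a v * psi T v = 0" by (simp add: psi_def)
    qed
    also have "\<dots> = bd a W f T" by (simp add: bd_def psi_def mult.assoc)
    finally show "(\<Sum>v\<in>link E W T. a v * psi T v) = 0" by (simp add: cycle)
  qed
  also have "\<dots> = (\<Sum>T\<in>indep E W n'. \<Sum>u\<in>link E W T. prod a T * a u * (f (insert u T))\<^sup>2 *
      (\<Sum>v\<in>link E W T. a v * excess E u v))"
  proof -
    have "(psi T u)\<^sup>2 = (f (insert u T))\<^sup>2" if "T \<in> indep E W n'" for T u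
      using ins_sign_square[OF fin[OF that], of u]
      by (simp add: psi_def power_mult_distrib power2_eq_square)
    then show ?thesis by (simp add: sum_distrib_left mult_ac)
  qed
  also have "\<dots> = (\<Sum>S\<in>indep E W n. \<Sum>u\<in>S. prod a (S - {u}) * a u * (f (insert u (S - {u})))\<^sup>2 *
      (\<Sum>v\<in>link E W (S - {u}). a v * excess E u v))"
    using sum_over_facets[OF finW, of E "\<lambda>T u. prod a T * a u * (f (insert u T))\<^sup>2 *
      (\<Sum>v\<in>link E W T. a v * excess E u v)" n'] E by (simp add: Suc)
  also have "\<dots> = ?R"
    using fin by (intro sum.cong refl)
      (simp add: insert_absorb prod.remove sum_distrib_left mult_ac)
  finally show ?thesis .
qed

text \<open>A cycle orthogonal to all boundaries pairs to zero with the boundary of its own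
  coboundary. The cross term and link estimates bound this pairing below by a sum of squares with
  strictly positive coefficients.\<close>

lemma harmonic_chain_zero:
  fixes a :: "'v::linorder \<Rightarrow> real"
  assumes finW: "finite W" and k: "k \<ge> 1"
    and E: "\<And>v. v \<in> W \<Longrightarrow> finite (E v) \<and> card (E v) = k"
    and a: "\<And>v. v \<in> W \<Longrightarrow> a v > 0"
    and load: "\<And>p. (\<Sum>v | v \<in> W \<and> p \<in> E v. a v) \<le> 1"
    and large: "real (k * n) < (\<Sum>v\<in>W. a v)"
    and supp: "\<And>S. f S \<noteq> 0 \<Longrightarrow> S \<in> indep E W n"
    and cycle: "bd a W f = (\<lambda>_. 0)"
    and orth: "\<And>R. R \<in> indep E W (Suc n) \<Longrightarrow>
      (\<Sum>S\<in>indep E W n. prod a S * f S * bd a W (\<lambda>T. of_bool (T = R)) S) = 0"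
  shows "f S = 0"
proof -
  have ne: "E v \<noteq> {}" if "v \<in> W" for v using E[OF that] k by auto
  have fin: "finite S" if "S \<in> indep E W m" for S m using indep_finite[OF finW that] .
  have finL: "finite (link E W T)" for T using finW by (simp add: link_def)
  have sub: "link E W T \<subseteq> W - T" for T using ne by (intro link_subset_Diff) simp
  have posp: "prod a S > 0" if "S \<in> indep E W m" for S m
    using a that by (intro prod_pos) (auto simp: indep_def)
  \<comment> \<open>\<open>y'\<close> is the coboundary of \<open>f\<close>; testing orthogonality against it gives the energy identity.\<close>
  define y where "y R = (\<Sum>u\<in>R. ins_sign u (R - {u}) * f (R - {u}))" for R
  define y' where "y' T = (\<Sum>R\<in>indep E W (Suc n). y R * of_bool (T = R))" for T
  have y': "y' T = (if T \<in> indep E W (Suc n) then y T else 0)" for T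
    by (simp add: y'_def sum_of_bool_eq finite_indep[OF finW])
  have "0 = (\<Sum>R\<in>indep E W (Suc n). y R *
      (\<Sum>S\<in>indep E W n. prod a S * f S * bd a W (\<lambda>T. of_bool (T = R)) S))"
    by (simp add: orth)
  also have "\<dots> = (\<Sum>S\<in>indep E W n. prod a S * f S *
      (\<Sum>R\<in>indep E W (Suc n). y R * bd a W (\<lambda>T. of_bool (T = R)) S))"
    unfolding sum_distrib_left by (subst sum.swap) (simp add: mult_ac)
  also have "\<dots> = (\<Sum>S\<in>indep E W n. prod a S * f S * bd a W y' S)"
    unfolding y'_def[abs_def] bd_sum ..
  also have "\<dots> = (\<Sum>S\<in>indep E W n. prod a S * (f S)\<^sup>2 * (\<Sum>v\<in>link E W S. a v)
      - (\<Sum>u\<in>S. prod a S * (\<Sum>v\<in>link E W S. a v *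
        (ins_sign u (S - {u}) * f S * (ins_sign v (S - {u}) * f (insert v (S - {u})))))))"
  proof (intro sum.cong refl)
    fix S assume S: "S \<in> indep E W n"
    have "bd a W y' S = (\<Sum>v\<in>link E W S. a v * (ins_sign v S * y (insert v S)))"
      unfolding bd_def
    proof (intro sum.mono_neutral_cong_right ballI)
      show "finite (W - S)" using finW by simp
      show "link E W S \<subseteq> W - S" by (rule sub)
      show "a v * ins_sign v S * y' (insert v S) = 0" if "v \<in> W - S - link E W S" for v
        using that insert_indep_iff[OF finW, of v S E n] ne by (auto simp: y')
      show "a v * ins_sign v S * y' (insert v S) = a v * (ins_sign v S * y (insert v S))"
        if "v \<in> link E W S" for v
        using that insert_indep_iff[OF finW, of v S E n] ne sub[of S] S by (auto simp: y')
    qed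
    \<comment> \<open>Removing the inserted vertex \<open>v\<close> gives back \<open>f S\<close>;
      removing an old vertex \<open>u\<close> exchanges \<open>u\<close> for \<open>v\<close>, with
      a minus sign.\<close>
    also have "\<dots> = (\<Sum>v\<in>link E W S. a v * (f S -
      (\<Sum>u\<in>S. ins_sign u (S - {u}) * (ins_sign v (S - {u}) * f (insert v (S - {u}))))))"
    proof (intro sum.cong refl arg_cong2[where f = "(*)"])
      fix v assume "v \<in> link E W S"
      then have v: "v \<notin> S" using sub by blast
      have "ins_sign v S * y (insert v S) = ins_sign v S * ins_sign v S * f S +
          (\<Sum>u\<in>S. ins_sign v S * ins_sign u (insert v S - {u}) * f (insert v S - {u}))"
        using v fin[OF S] by (simp add: y_def sum_distrib_left distrib_left mult.assoc)
      also have "(\<Sum>u\<in>S. ins_sign v S * ins_sign u (insert v S - {u}) * f (insert v S - {u})) =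
          (\<Sum>u\<in>S. - (ins_sign u (S - {u}) * (ins_sign v (S - {u}) * f (insert v (S - {u})))))"
      proof (intro sum.cong refl)
        fix u assume u: "u \<in> S"
        with v have uv: "u \<noteq> v" and eq: "insert v S - {u} = insert v (S - {u})" by auto
        have "ins_sign v S * ins_sign u (insert v (S - {u})) = - (ins_sign u (S - {u}) * ins_sign v (S - {u}))"
          using ins_sign_exchange[of u "S - {u}" v] u v uv by (simp add: insert_absorb)
        then show "ins_sign v S * ins_sign u (insert v S - {u}) * f (insert v S - {u}) =
            - (ins_sign u (S - {u}) * (ins_sign v (S - {u}) * f (insert v (S - {u}))))"
          by (simp add: eq)
      qed
      finally show "ins_sign v S * y (insert v S) = f S -
          (\<Sum>u\<in>S. ins_sign u (S - {u}) * (ins_sign v (S - {u}) * f (insert v (S - {u}))))"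
        by (simp add: ins_sign_square[OF fin[OF S]] sum_negf)
    qed
    also have "\<dots> = f S * (\<Sum>v\<in>link E W S. a v) - (\<Sum>v\<in>link E W S. \<Sum>u\<in>S.
        a v * (ins_sign u (S - {u}) * (ins_sign v (S - {u}) * f (insert v (S - {u})))))"
      by (simp add: right_diff_distrib sum_subtractf sum_distrib_left mult.commute[of _ "f S"])
    also have "(\<Sum>v\<in>link E W S. \<Sum>u\<in>S.
        a v * (ins_sign u (S - {u}) * (ins_sign v (S - {u}) * f (insert v (S - {u}))))) =
      (\<Sum>u\<in>S. \<Sum>v\<in>link E W S.
        a v * (ins_sign u (S - {u}) * (ins_sign v (S - {u}) * f (insert v (S - {u})))))"
      by (rule sum.swap)
    finally have eq: "bd a W y' S = f S * (\<Sum>v\<in>link E W S. a v) - \<dots>" .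
    show "prod a S * f S * bd a W y' S = prod a S * (f S)\<^sup>2 * (\<Sum>v\<in>link E W S. a v)
      - (\<Sum>u\<in>S. prod a S * (\<Sum>v\<in>link E W S. a v *
        (ins_sign u (S - {u}) * f S * (ins_sign v (S - {u}) * f (insert v (S - {u}))))))"
      unfolding eq by (simp add: right_diff_distrib sum_distrib_left power2_eq_square mult_ac)
  qed
  also have "\<dots> \<ge> (\<Sum>S\<in>indep E W n. prod a S * (f S)\<^sup>2 * (\<Sum>v\<in>link E W S. a v)) -
      (\<Sum>S\<in>indep E W n. prod a S * (f S)\<^sup>2 * (\<Sum>u\<in>S. \<Sum>v\<in>link E W (S - {u}). a v * excess E u v))"
    unfolding sum_subtractf
    using cross_term_bound[OF finW _ a supp cycle] E ne by (intro diff_left_mono) simp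
  finally have "(\<Sum>S\<in>indep E W n. prod a S * (f S)\<^sup>2 * ((\<Sum>v\<in>link E W S. a v) -
      (\<Sum>u\<in>S. \<Sum>v\<in>link E W (S - {u}). a v * excess E u v))) \<le> 0"
    by (simp add: right_diff_distrib sum_subtractf)
  \<comment> \<open>The strict inequality \<open>large\<close> enters here and makes every
    coefficient positive.\<close>
  moreover have gap: "(\<Sum>v\<in>link E W S. a v) -
      (\<Sum>u\<in>S. \<Sum>v\<in>link E W (S - {u}). a v * excess E u v) > 0" if "S \<in> indep E W n" for S
    using link_weight_bound[OF finW that E a load] large by simp
  moreover have nonneg: "prod a S * (f S)\<^sup>2 * ((\<Sum>v\<in>link E W S. a v) -
      (\<Sum>u\<in>S. \<Sum>v\<in>link E W (S - {u}). a v * excess E u v)) \<ge> 0" if "S \<in> indep E W n" for S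
    using gap[OF that] posp[OF that] by simp
  ultimately have "\<forall>S\<in>indep E W n. prod a S * (f S)\<^sup>2 * ((\<Sum>v\<in>link E W S. a v) -
      (\<Sum>u\<in>S. \<Sum>v\<in>link E W (S - {u}). a v * excess E u v)) = 0"
    using finite_indep[OF finW]
    by (subst sum_nonneg_eq_0_iff[symmetric]) (auto intro: antisym sum_nonneg)
  then have "f S = 0" if "S \<in> indep E W n" for S
    using gap[OF that] posp[OF that] that by fastforce
  then show ?thesis using supp by blast
qed

text \<open>Hodge argument: subtracting from \<open>z\<close> its projection onto the boundaries of
  faces leaves a cycle orthogonal to all of them, which is zero by
  \<open>harmonic_chain_zero\<close>.\<close>

lemma cycle_is_boundary:
  fixes a :: "'v::linorder \<Rightarrow> real"
  assumes finW: "finite W" and k: "k \<ge> 1"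
    and E: "\<And>v. v \<in> W \<Longrightarrow> finite (E v) \<and> card (E v) = k"
    and a: "\<And>v. v \<in> W \<Longrightarrow> a v > 0"
    and load: "\<And>p. (\<Sum>v | v \<in> W \<and> p \<in> E v. a v) \<le> 1"
    and large: "real (k * n) < (\<Sum>v\<in>W. a v)"
    and supp: "\<And>S. z S \<noteq> 0 \<Longrightarrow> S \<in> indep E W n"
    and cycle: "bd a W z = (\<lambda>_. 0)"
  shows "\<exists>g. (\<forall>S. g S \<noteq> 0 \<longrightarrow> S \<in> indep E W (Suc n)) \<and> bd a W g = z"
proof -
  have ne: "E v \<noteq> {}" if "v \<in> W" for v using E[OF that] k by auto
  define b where "b R = bd a W (\<lambda>T. of_bool (T = R))" for R
  have posp: "prod a S > 0" if "S \<in> indep E W m" for S m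
    using a that by (intro prod_pos) (auto simp: indep_def)
  obtain c where c: "\<And>R. R \<in> indep E W (Suc n) \<Longrightarrow>
      (\<Sum>S\<in>indep E W n. prod a S * (z S - (\<Sum>Q\<in>indep E W (Suc n). c Q * b Q S)) * b R S) = 0"
    using exists_projection[OF finite_indep[OF finW, of E "Suc n"] finite_indep[OF finW, of E n],
        where w = "prod a" and z = z and b = b] posp[of _ n] by auto
  define g where "g T = (\<Sum>Q\<in>indep E W (Suc n). c Q * of_bool (T = Q))" for T
  have gsupp: "S \<in> indep E W (Suc n)" if "g S \<noteq> 0" for S
    using that unfolding g_def sum_of_bool_eq[OF finite_indep[OF finW]] by (simp split: if_splits)
  have bg: "bd a W g = (\<lambda>S. \<Sum>Q\<in>indep E W (Suc n). c Q * b Q S)"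
    unfolding g_def[abs_def] bd_sum b_def ..
  have bgsupp: "S \<in> indep E W n" if nz: "bd a W g S \<noteq> 0" for S
  proof -
    obtain v where v: "v \<in> W - S" "g (insert v S) \<noteq> 0"
      using nz unfolding bd_def by (metis (no_types, lifting) mult_zero_right sum.neutral)
    then show ?thesis
      using gsupp[of "insert v S"] insert_indep_iff[OF finW, of v S E n] ne by auto
  qed
  have "z S - bd a W g S = 0" for S
  proof (rule harmonic_chain_zero[OF finW k E a load large])
    show "S \<in> indep E W n" if "z S - bd a W g S \<noteq> 0" for S
      using that supp[of S] bgsupp[of S] by (cases "z S = 0") auto
    show "bd a W (\<lambda>S. z S - bd a W g S) = (\<lambda>_. 0)"
      by (simp add: bd_diff cycle bd_bd[OF finW])
    show "(\<Sum>S\<in>indep E W n. prod a S * (z S - bd a W g S) * bd a W (\<lambda>T. of_bool (T = R)) S) = 0"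
      if "R \<in> indep E W (Suc n)" for R
      using c[OF that] by (simp add: bg b_def)
  qed
  then have "bd a W g = z" by auto
  with gsupp show ?thesis by blast
qed

section \<open>Boundary operators of single colours\<close>

text \<open>The list fixes an order of composition; for finite classes another order changes only
  the sign.\<close>

fun colour_bd :: "('v::linorder \<Rightarrow> real) \<Rightarrow> ('c \<Rightarrow> 'v set) \<Rightarrow> 'c list \<Rightarrow> ('v set \<Rightarrow> real) \<Rightarrow> 'v set \<Rightarrow> real" where
  "colour_bd a K [] f = f"
| "colour_bd a K (i # is) f = colour_bd a K is (bd a (K i) f)"

lemma colour_bd_zero [simp]: "colour_bd a K is (\<lambda>_. 0) = (\<lambda>_. 0)"
  by (induction "is") simp_all

lemma colour_bd_uminus: "colour_bd a K is (\<lambda>T. - f T) = (\<lambda>T. - colour_bd a K is f T)"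
  by (induction "is" arbitrary: f) (simp_all add: bd_uminus)

lemma colour_bd_sum:
  "colour_bd a K is (\<lambda>T. \<Sum>i\<in>I. c i * f i T) = (\<lambda>T. \<Sum>i\<in>I. c i * colour_bd a K is (f i) T)"
  by (induction "is" arbitrary: f) (simp_all add: bd_sum)

text \<open>Anticommutation moves \<open>bd a (K j)\<close> past the other factors until it meets
  its own copy, and the square is zero.\<close>

lemma colour_bd_bd_eq_zero:
  assumes "\<And>i. finite (K i)" "j \<in> set is"
  shows "colour_bd a K is (bd a (K j) f) = (\<lambda>_. 0)"
  using assms(2)
proof (induction "is" arbitrary: f)
  case (Cons i "is")
  show ?case
  proof (cases "i = j")
    case True
    then show ?thesis using assms(1) by (simp add: bd_bd)
  next
    case False
    then show ?thesis
      using Cons assms(1) bd_anticommute[of "K i" "K j" a f]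
      by (simp add: colour_bd_uminus)
  qed
qed simp

lemma bd_disjoint_support:
  assumes "\<And>S. f S \<noteq> 0 \<Longrightarrow> S \<inter> B = {}"
  shows "bd a B f = (\<lambda>_. 0)" "bd a A f S \<noteq> 0 \<Longrightarrow> S \<inter> B = {}"
proof -
  show "bd a B f = (\<lambda>_. 0)"
    unfolding bd_def fun_eq_iff using assms by (intro allI sum.neutral ballI) fastforce
  assume "bd a A f S \<noteq> 0"
  then obtain v where "f (insert v S) \<noteq> 0"
    unfolding bd_def by (metis (no_types, lifting) mult_zero_right sum.neutral)
  then show "S \<inter> B = {}" using assms by blast
qed

text \<open>Boundaries pass to subsets, so the support stays away from \<open>K j\<close> until the
  factor of colour \<open>j\<close> annihilates the chain.\<close>

lemma colour_bd_disjoint_support: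
  assumes "j \<in> set is" "\<And>S. f S \<noteq> 0 \<Longrightarrow> S \<inter> K j = {}"
  shows "colour_bd a K is f = (\<lambda>_. 0)"
  using assms
proof (induction "is" arbitrary: f)
  case (Cons i "is")
  show ?case
  proof (cases "i = j")
    case True
    then show ?thesis using Cons.prems bd_disjoint_support(1)[of f "K j" a] by simp
  next
    case False
    then show ?thesis
      using Cons bd_disjoint_support(2)[of f "K j" a "K i"] by simp
  qed
qed simp

text \<open>Undoing the factors one at a time adds to \<open>T\<close> a vertex of each
  class.\<close>

lemma colour_bd_nonzero:
  assumes "colour_bd a K is f T \<noteq> 0"
  shows "\<exists>S. f S \<noteq> 0 \<and> (\<forall>i\<in>set is. S \<inter> K i \<noteq> {})"
  using assms
proof (induction "is" arbitrary: f)
  case (Cons i "is")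
  obtain S where S: "bd a (K i) f S \<noteq> 0" "\<forall>j\<in>set is. S \<inter> K j \<noteq> {}"
    using Cons.IH[of "bd a (K i) f"] Cons.prems by auto
  then obtain v where "v \<in> K i" "f (insert v S) \<noteq> 0"
    unfolding bd_def by (metis (no_types, lifting) DiffD1 mult_zero_right sum.neutral)
  with S(2) show ?case by (intro exI[of _ "insert v S"]) auto
qed auto

text \<open>\<open>F\<close> acts like a chain map from the full simplex on the colours
  \<open>C\<close>, sending the face \<open>I\<close> to a chain on the classes in
  \<open>I\<close>.\<close>

locale chain_system =
  fixes a :: "'v::linorder \<Rightarrow> real" and K :: "'c::linorder \<Rightarrow> 'v set" and C :: "'c set"
    and F :: "'c set \<Rightarrow> 'v set \<Rightarrow> real"
  assumes finite_colours: "finite C"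
    and finite_class: "\<And>i. finite (K i)"
    and disjoint_classes: "\<And>i j. i \<noteq> j \<Longrightarrow> K i \<inter> K j = {}"
    and empty_chain: "F {} {} \<noteq> 0"
    and chain_support: "\<And>I S. I \<subseteq> C \<Longrightarrow> F I S \<noteq> 0 \<Longrightarrow> S \<subseteq> (\<Union>i\<in>I. K i)"
    and chain_boundary: "\<And>I. I \<subseteq> C \<Longrightarrow>
      bd a (\<Union>i\<in>I. K i) (F I) = (\<lambda>T. \<Sum>i\<in>I. ins_sign i (I - {i}) * F (I - {i}) T)"
begin

text \<open>The factor 1 gives the sum the shape expected by \<open>colour_bd_sum\<close>.\<close>

lemma bd_Union: "finite I \<Longrightarrow> bd a (\<Union>i\<in>I. K i) f = (\<lambda>T. \<Sum>i\<in>I. 1 * bd a (K i) f T)"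
proof
  fix T assume "finite I"
  have eq: "(\<Union>i\<in>I. K i) - T = (\<Union>i\<in>I. K i - T)" by blast
  show "bd a (\<Union>i\<in>I. K i) f T = (\<Sum>i\<in>I. 1 * bd a (K i) f T)"
    unfolding bd_def mult_1 eq
  proof (rule sum.UNION_disjoint)
    show "\<forall>i\<in>I. \<forall>j\<in>I. i \<noteq> j \<longrightarrow> (K i - T) \<inter> (K j - T) = {}"
      using disjoint_classes by blast
  qed (simp_all add: finite_class \<open>finite I\<close>)
qed

text \<open>Peeling off one colour replaces the chain by the chain without that colour, up to sign.
  The final value is thus \<open>F {} {}\<close> up to sign.\<close>

lemma colour_bd_chain_nonzero:
  assumes "distinct is" "set is \<subseteq> C"
  shows "colour_bd a K is (F (set is)) {} \<noteq> 0"
  using assms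
proof (induction "is")
  case Nil
  then show ?case using empty_chain by simp
next
  case (Cons i "is")
  let ?I = "set (i # is)"
  have i: "i \<notin> set is" using Cons.prems by simp
  \<comment> \<open>The remaining operators annihilate \<open>bd a (K j)\<close> for every
    \<open>j\<close> in \<open>is\<close>, so the boundary of colour \<open>i\<close> may be
    replaced by the full one.\<close>
  have "colour_bd a K (i # is) (F ?I) = (\<lambda>T. \<Sum>j\<in>?I. 1 * colour_bd a K is (bd a (K j) (F ?I)) T)"
    using i by (simp add: colour_bd_bd_eq_zero[where K = K, OF finite_class] fun_eq_iff)
  also have "\<dots> = colour_bd a K is (bd a (\<Union>j\<in>?I. K j) (F ?I))"
    by (simp only: bd_Union[OF finite_set] colour_bd_sum)
  also have "\<dots> = (\<lambda>T. \<Sum>j\<in>?I. ins_sign j (?I - {j}) * colour_bd a K is (F (?I - {j})) T)"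
    using Cons.prems(2) by (subst chain_boundary) (simp_all only: colour_bd_sum)
  also have "\<dots> = (\<lambda>T. ins_sign i (set is) * colour_bd a K is (F (set is)) T)"
  proof -
    \<comment> \<open>A facet lacking a colour of \<open>is\<close> is annihilated by the factor of
      that colour, so only the facet without \<open>i\<close> remains.\<close>
    have zero: "colour_bd a K is (F (?I - {j})) = (\<lambda>_. 0)" if "j \<in> set is" for j
    proof (rule colour_bd_disjoint_support[OF that])
      fix S assume "F (?I - {j}) S \<noteq> 0"
      then have "S \<subseteq> (\<Union>i\<in>?I - {j}. K i)"
        using Cons.prems(2) by (intro chain_support) auto
      then show "S \<inter> K j = {}" using disjoint_classes by fastforce
    qed
    have "?I - {i} = set is" using i by auto
    then show ?thesis using i zero by (simp add: fun_eq_iff)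
  qed
  finally show ?case
    using Cons by (simp add: ins_sign_nonzero)
qed

lemma exists_rainbow_set: "\<exists>S. F C S \<noteq> 0 \<and> (\<forall>i\<in>C. S \<inter> K i \<noteq> {})"
proof -
  obtain "is" where "set is = C" "distinct is"
    using finite_distinct_list[OF finite_colours] by blast
  then show ?thesis
    using colour_bd_nonzero[OF colour_bd_chain_nonzero, of "is"] by auto
qed

end

section \<open>Construction of the chains by filling\<close>

text \<open>Deleting \<open>i\<close> and \<open>j\<close> in either order gives the same set with
  opposite signs. This makes the prescribed boundary a cycle.\<close>

lemma alternating_facets_cancel:
  fixes F :: "'c::linorder set \<Rightarrow> real"
  assumes "finite I"
  shows "(\<Sum>i\<in>I. ins_sign i (I - {i}) * (\<Sum>j\<in>I - {i}. ins_sign j (I - {i} - {j}) * F (I - {i} - {j}))) = 0"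
    (is "?s = 0")
proof -
  define h where "h i j = (if i = j then 0 else
    ins_sign i (I - {i}) * (ins_sign j (I - {i} - {j}) * F (I - {i} - {j})))" for i j
  have s: "?s = (\<Sum>i\<in>I. \<Sum>j\<in>I. h i j)"
    unfolding sum_distrib_left h_def using assms
    by (intro sum.cong refl sum.mono_neutral_cong_left) auto
  have "h i j = - h j i" if "i \<in> I" "j \<in> I" for i j
  proof (cases "i = j")
    case False
    let ?T = "I - {i} - {j}"
    have T: "I - {j} - {i} = ?T" "I - {i} = insert j ?T" "I - {j} = insert i ?T"
      using that False by auto
    have "ins_sign i (insert j ?T) * ins_sign j ?T = - (ins_sign j (insert i ?T) * ins_sign i ?T)"
      using ins_sign_swap[of i ?T j] False by (simp add: mult.commute)
    then have "ins_sign i (I - {i}) * ins_sign j ?T = - (ins_sign j (I - {j}) * ins_sign i ?T)"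
      by (simp only: T(2,3)[symmetric])
    then show ?thesis using False by (simp add: h_def T(1) flip: mult.assoc)
  qed (simp add: h_def)
  then have "(\<Sum>i\<in>I. \<Sum>j\<in>I. h i j) = (\<Sum>i\<in>I. \<Sum>j\<in>I. - h j i)"
    by (intro sum.cong refl)
  also have "\<dots> = - (\<Sum>i\<in>I. \<Sum>j\<in>I. h i j)"
    by (subst sum.swap) (simp add: sum_negf)
  finally show ?thesis by (simp add: s)
qed


lemma indep_mono: "U \<subseteq> W \<Longrightarrow> indep E U n \<subseteq> indep E W n"
  by (auto simp: indep_def)

text \<open>Induction on the number of colours, for all \<open>I\<close> at once. The prescribed
  boundary of \<open>F I\<close> lives on sets with one element fewer than \<open>I\<close>, while
  the classes in \<open>I\<close> weigh at least \<open>k * card I\<close>; this slack allows the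
  filling.\<close>

lemma exists_chain_family:
  fixes a :: "'v::linorder \<Rightarrow> real" and K :: "'c::linorder \<Rightarrow> 'v set"
  assumes finC: "finite C" and finK: "\<And>i. finite (K i)" and k: "k \<ge> 1"
    and disj: "\<And>i j. i \<noteq> j \<Longrightarrow> K i \<inter> K j = {}"
    and E: "\<And>i v. i \<in> C \<Longrightarrow> v \<in> K i \<Longrightarrow> finite (E v) \<and> card (E v) = k"
    and a: "\<And>i v. i \<in> C \<Longrightarrow> v \<in> K i \<Longrightarrow> a v > 0"
    and load: "\<And>p. (\<Sum>v | v \<in> (\<Union>i\<in>C. K i) \<and> p \<in> E v. a v) \<le> 1"
    and heavy: "\<And>i. i \<in> C \<Longrightarrow> real k \<le> (\<Sum>v\<in>K i. a v)"
  shows "\<exists>F. F {} {} \<noteq> 0 \<and> (\<forall>I. I \<subseteq> C \<and> card I \<le> n \<longrightarrow>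
    (\<forall>S. F I S \<noteq> 0 \<longrightarrow> S \<in> indep E (\<Union>i\<in>I. K i) (card I)) \<and>
    bd a (\<Union>i\<in>I. K i) (F I) = (\<lambda>T. \<Sum>i\<in>I. ins_sign i (I - {i}) * F (I - {i}) T))"
proof (induction n)
  case 0
  have "I \<subseteq> C \<and> card I \<le> 0 \<longleftrightarrow> I = {}" for I
    using finC finite_subset[of I C] by auto
  then show ?case
    \<comment> \<open>Only \<open>I = {}\<close> occurs; its chain is the unit on the empty set, and
      both boundary sums are empty.\<close>
    by (intro exI[of _ "\<lambda>_ T. of_bool (T = {})"])
      (auto simp: bd_def indep_def disjoint_family_on_def)
next
  case (Suc n)
  define U where "U I = (\<Union>i\<in>I. K i)" for I
  define rhs where "rhs F I = (\<lambda>T. \<Sum>i\<in>I. ins_sign i (I - {i}) * F (I - {i}) T)"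
    for F :: "'c set \<Rightarrow> 'v set \<Rightarrow> real" and I
  obtain F where F0: "F {} {} \<noteq> 0"
    and Fsupp: "\<And>I S. I \<subseteq> C \<Longrightarrow> card I \<le> n \<Longrightarrow> F I S \<noteq> 0 \<Longrightarrow> S \<in> indep E (U I) (card I)"
    and Fbd: "\<And>I. I \<subseteq> C \<Longrightarrow> card I \<le> n \<Longrightarrow> bd a (U I) (F I) = rhs F I"
    using Suc unfolding U_def rhs_def by blast
  have "\<exists>g. (\<forall>S. g S \<noteq> 0 \<longrightarrow> S \<in> indep E (U I) (Suc n)) \<and> bd a (U I) g = rhs F I"
    if I: "I \<subseteq> C" and cI: "card I = Suc n" for I
  proof (rule cycle_is_boundary[OF _ k])
    have finI: "finite I" using I finC finite_subset by blast
    show finU: "finite (U I)" using finI finK by (simp add: U_def)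
    have UC: "U I \<subseteq> (\<Union>i\<in>C. K i)" using I by (auto simp: U_def)
    show Ek: "finite (E v) \<and> card (E v) = k" and av: "a v > 0" if "v \<in> U I" for v
      using that I E a by (auto simp: U_def)
    show "(\<Sum>v | v \<in> U I \<and> p \<in> E v. a v) \<le> 1" for p
    proof -
      have "(\<Sum>v | v \<in> U I \<and> p \<in> E v. a v) \<le> (\<Sum>v | v \<in> (\<Union>i\<in>C. K i) \<and> p \<in> E v. a v)"
        using UC a finC finK by (intro sum_mono2) (auto intro: less_imp_le)
      then show ?thesis using load[of p] by simp
    qed
    have "real (k * n) < real (k * card I)" using k by (simp add: cI)
    also have "\<dots> = (\<Sum>i\<in>I. real k)" by simp
    also have "\<dots> \<le> (\<Sum>i\<in>I. \<Sum>v\<in>K i. a v)" using heavy I by (intro sum_mono) auto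
    also have "\<dots> = (\<Sum>v\<in>U I. a v)"
      unfolding U_def using finI finK disj by (subst sum.UNION_disjoint) auto
    finally show "real (k * n) < (\<Sum>v\<in>U I. a v)" .
    have facet: "I - {i} \<subseteq> C" "card (I - {i}) = n" "U (I - {i}) \<subseteq> U I" if "i \<in> I" for i
      using that I cI finI by (auto simp: U_def)
    show "S \<in> indep E (U I) n" if nz: "rhs F I S \<noteq> 0" for S
    proof -
      obtain i where i: "i \<in> I" "F (I - {i}) S \<noteq> 0"
        using nz unfolding rhs_def by (metis (no_types, lifting) mult_zero_right sum.neutral)
      then have "S \<in> indep E (U (I - {i})) n"
        using Fsupp[of "I - {i}" S] facet[OF i(1)] by simp
      then show ?thesis using indep_mono[OF facet(3)[OF i(1)]] by blast
    qed
    \<comment> \<open>The chain of a facet lives on its own colours, so the larger ground set does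
      not change its boundary.\<close>
    have "bd a (U I) (F (I - {i})) = rhs F (I - {i})" if i: "i \<in> I" for i
    proof -
      have "S \<subseteq> U (I - {i})" if "F (I - {i}) S \<noteq> 0" for S
        using Fsupp[of "I - {i}" S] facet[OF i] that by (auto simp: indep_def)
      then have "bd a (U I) (F (I - {i})) = bd a (U (I - {i})) (F (I - {i}))"
        using finU facet(3)[OF i] by (intro bd_restrict)
      then show ?thesis using Fbd facet[OF i] by simp
    qed
    then have "bd a (U I) (rhs F I) = (\<lambda>T. \<Sum>i\<in>I. ins_sign i (I - {i}) * rhs F (I - {i}) T)"
      unfolding rhs_def[of F I] bd_sum by simp
    also have "\<dots> = (\<lambda>_. 0)"
      unfolding rhs_def using alternating_facets_cancel[OF finI] by (intro ext)
    finally show "bd a (U I) (rhs F I) = (\<lambda>_. 0)" .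
  qed
  then obtain g where g: "\<And>I. I \<subseteq> C \<Longrightarrow> card I = Suc n \<Longrightarrow>
      (\<forall>S. g I S \<noteq> 0 \<longrightarrow> S \<in> indep E (U I) (Suc n)) \<and> bd a (U I) (g I) = rhs F I"
    by metis
  \<comment> \<open>For sets of at most \<open>Suc n\<close> colours, \<open>rhs\<close> refers only
    to facets of size at most \<open>n\<close>, where the family is unchanged.\<close>
  define F' where "F' I = (if card I = Suc n then g I else F I)" for I
  have rhs': "rhs F' I = rhs F I" if "I \<subseteq> C" "card I \<le> Suc n" for I
  proof -
    have "card (I - {i}) \<noteq> Suc n" if "i \<in> I" for i
      using that \<open>card I \<le> Suc n\<close> finite_subset[OF \<open>I \<subseteq> C\<close> finC]
      by (metis card_Diff1_less not_less)
    then show ?thesis by (simp add: rhs_def F'_def)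
  qed
  have "F' {} {} \<noteq> 0" using F0 by (simp add: F'_def)
  moreover have "(\<forall>S. F' I S \<noteq> 0 \<longrightarrow> S \<in> indep E (U I) (card I)) \<and> bd a (U I) (F' I) = rhs F' I"
    if "I \<subseteq> C" "card I \<le> Suc n" for I
    using that g[of I] Fsupp[of I] Fbd[of I] rhs'[of I] by (cases "card I = Suc n") (auto simp: F'_def)
  ultimately show ?case unfolding U_def rhs_def by blast
qed

text \<open>The chain of all colours is nonzero on some set meeting every class, and its support
  consists of sets of pairwise disjoint edges.\<close>

lemma weighted_rainbow_matching:
  fixes a :: "'v::linorder \<Rightarrow> real" and K :: "'c::linorder \<Rightarrow> 'v set"
  assumes finC: "finite C" and finK: "\<And>i. finite (K i)" and k: "k \<ge> 1"
    and disj: "\<And>i j. i \<noteq> j \<Longrightarrow> K i \<inter> K j = {}"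
    and E: "\<And>i v. i \<in> C \<Longrightarrow> v \<in> K i \<Longrightarrow> finite (E v) \<and> card (E v) = k"
    and a: "\<And>i v. i \<in> C \<Longrightarrow> v \<in> K i \<Longrightarrow> a v > 0"
    and load: "\<And>p. (\<Sum>v | v \<in> (\<Union>i\<in>C. K i) \<and> p \<in> E v. a v) \<le> 1"
    and heavy: "\<And>i. i \<in> C \<Longrightarrow> real k \<le> (\<Sum>v\<in>K i. a v)"
  shows "\<exists>S. disjoint_family_on E S \<and> (\<forall>i\<in>C. S \<inter> K i \<noteq> {})"
proof -
  have "\<exists>F. F {} {} \<noteq> 0 \<and> (\<forall>I. I \<subseteq> C \<and> card I \<le> card C \<longrightarrow>
      (\<forall>S. F I S \<noteq> 0 \<longrightarrow> S \<in> indep E (\<Union>i\<in>I. K i) (card I)) \<and>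
      bd a (\<Union>i\<in>I. K i) (F I) = (\<lambda>T. \<Sum>i\<in>I. ins_sign i (I - {i}) * F (I - {i}) T))"
    by (rule exists_chain_family[where k = k]) (fact assms)+
  then obtain F where F0: "F {} {} \<noteq> 0"
    and F: "\<And>I. I \<subseteq> C \<Longrightarrow> card I \<le> card C \<Longrightarrow>
      (\<forall>S. F I S \<noteq> 0 \<longrightarrow> S \<in> indep E (\<Union>i\<in>I. K i) (card I)) \<and>
      bd a (\<Union>i\<in>I. K i) (F I) = (\<lambda>T. \<Sum>i\<in>I. ins_sign i (I - {i}) * F (I - {i}) T)"
    by blast
  have cI: "card I \<le> card C" if "I \<subseteq> C" for I using that finC by (rule card_mono[rotated])
  interpret chain_system a K C F
    using finC finK disj F0 F cI by unfold_locales (auto simp: indep_def)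
  obtain S where S: "F C S \<noteq> 0" "\<forall>i\<in>C. S \<inter> K i \<noteq> {}"
    using exists_rainbow_set by blast
  then show ?thesis using F[of C] by (auto simp: indep_def)
qed

section \<open>Passage from hypergraphs to weighted vertices\<close>

text \<open>Multiplicity is traded for the index of the hypergraph, so that degrees count the pairs
  serving as vertices of the complex.\<close>

lemma deg_multi_union:
  assumes "\<And>i. i \<in> {1..m} \<Longrightarrow> finite (H i)"
  shows "deg (multi_union m H) x = card {p \<in> Sigma {1..m} H. x \<in> snd p}"
proof -
  have size_sum: "size (filter_mset P (\<Sum>j\<in>A. M j)) = (\<Sum>j\<in>A. size (filter_mset P (M j)))"
    if "finite A" for A :: "nat set" and M :: "nat \<Rightarrow> 'a set multiset" and P
    using that by (induction A rule: finite_induct) auto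
  have "deg (multi_union m H) x = (\<Sum>j\<in>{1..m}. card {e \<in> H j. x \<in> e})"
    using assms by (simp add: deg_def multi_union_def size_sum)
  also have "\<dots> = card (Sigma {1..m} (\<lambda>j. {e \<in> H j. x \<in> e}))"
    using assms by (subst card_SigmaI) auto
  also have "Sigma {1..m} (\<lambda>j. {e \<in> H j. x \<in> e}) = {p \<in> Sigma {1..m} H. x \<in> snd p}"
    by auto
  finally show ?thesis .
qed

theorem theorem3p4:
  fixes k m :: nat and V :: "'a set" and H :: "nat \<Rightarrow> 'a set set"
  assumes "k \<ge> 1" and "m \<ge> 1"
    and "\<And>i. i \<in> {1..m} \<Longrightarrow> hypergraph_on V (H i)"
    and "\<And>i. i \<in> {1..m} \<Longrightarrow> finite (H i)"
    and "\<And>i. i \<in> {1..m} \<Longrightarrow> H i \<noteq> {}"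
    and "\<And>i. i \<in> {1..m} \<Longrightarrow> uniform k (H i)"
    and "\<And>i. i \<in> {1..m} \<Longrightarrow> card (H i) \<ge> k * max_deg (multi_union m H) (\<Union>(H i))"
  shows "\<exists>f. is_SJR m H f"
proof -
  define P where "P = Sigma {1..m} H"
  define D where "D i = max_deg (multi_union m H) (\<Union>(H i))" for i
  have finP: "finite P" unfolding P_def using assms(4) by (intro finite_SigmaI) auto
  \<comment> \<open>The signs need a linear order, which \<open>'a\<close> need not carry; numbering
    the pairs supplies one.\<close>
  obtain h where h: "bij_betw h {0..<card P} P"
    using ex_bij_betw_nat_finite[OF finP] by blast
  define W where "W = {0..<card P}"
  define E where "E v = snd (h v)" for v
  define K where "K i = {v \<in> W. fst (h v) = i}" for i
  define a where "a v = 1 / real (D (fst (h v)))" for v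
  have hW: "fst (h v) \<in> {1..m}" "E v \<in> H (fst (h v))" if "v \<in> W" for v
    using bij_betwE[OF h] that by (force simp: P_def W_def E_def)+
  have card_eq: "card {v \<in> W. Q (h v)} = card {p \<in> P. Q p}" for Q
  proof (rule bij_betw_same_card)
    show "bij_betw h {v \<in> W. Q (h v)} {p \<in> P. Q p}"
      using h unfolding bij_betw_def W_def[symmetric] by (auto intro: inj_on_subset)
  qed
  have edge: "finite e \<and> card e = k \<and> e \<noteq> {}" if "i \<in> {1..m}" "e \<in> H i" for i e
    using assms(3,6)[OF that(1)] that(2) by (auto simp: uniform_def hypergraph_on_def)
  have deg_D: "deg (multi_union m H) x \<le> D i" if "i \<in> {1..m}" "e \<in> H i" "x \<in> e" for i e x
  proof -
    have "finite (\<Union>(H i))" using assms(4) edge that(1) by auto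
    then show ?thesis unfolding D_def max_deg_def using that by (intro Max_ge) auto
  qed
  have degW: "deg (multi_union m H) x = card {v \<in> W. x \<in> E v}" for x
    using card_eq[of "\<lambda>p. x \<in> snd p"] deg_multi_union[of m H x, OF assms(4)] by (simp add: P_def E_def)
  have deg_pos: "deg (multi_union m H) x > 0" if "v \<in> W" "x \<in> E v" for v x
    unfolding degW using that by (auto simp: card_gt_0_iff W_def)
  have D_pos: "D (fst (h v)) > 0" if v: "v \<in> W" for v
  proof -
    obtain x where "x \<in> E v" using edge[OF hW[OF v]] by blast
    then show ?thesis using deg_pos[OF v] deg_D[OF hW[OF v]] by fastforce
  qed
  have UK: "(\<Union>i\<in>{1..m}. K i) = W" using hW(1) by (auto simp: K_def)
  have "\<exists>S. disjoint_family_on E S \<and> (\<forall>i\<in>{1..m}. S \<inter> K i \<noteq> {})"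
  proof (rule weighted_rainbow_matching[OF _ _ assms(1)])
    show "finite (K i)" for i by (simp add: K_def W_def)
    show "K i \<inter> K j = {}" if "i \<noteq> j" for i j using that by (auto simp: K_def)
    show "finite (E v) \<and> card (E v) = k" if "v \<in> K i" for i v
      using that edge hW by (auto simp: K_def)
    show "a v > 0" if "v \<in> K i" for i v
      using that D_pos by (auto simp: K_def a_def)
    show "(\<Sum>v | v \<in> (\<Union>i\<in>{1..m}. K i) \<and> p \<in> E v. a v) \<le> 1" for p
    proof -
      \<comment> \<open>Each edge through \<open>p\<close> weighs at most the reciprocal of the
        degree of \<open>p\<close>, and that degree counts these edges. For degree 0 the sum is
        empty.\<close>
      have "(\<Sum>v | v \<in> W \<and> p \<in> E v. a v) \<le> (\<Sum>v | v \<in> W \<and> p \<in> E v. 1 / real (deg (multi_union m H) p))"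
        unfolding a_def using deg_D[OF hW] deg_pos
        by (intro sum_mono divide_left_mono) (auto intro!: mult_pos_pos D_pos)
      also have "\<dots> \<le> 1" by (simp add: degW)
      finally show ?thesis by (simp only: UK)
    qed
    show "real k \<le> (\<Sum>v\<in>K i. a v)" if i: "i \<in> {1..m}" for i
    proof -
      have "{p \<in> P. fst p = i} = {i} \<times> H i" using i by (auto simp: P_def)
      then have cK: "card (K i) = card (H i)"
        using card_eq[of "\<lambda>p. fst p = i"] by (simp add: K_def card_cartesian_product)
      then have "K i \<noteq> {}" using assms(4,5)[OF i] by auto
      then have D: "D i > 0" using D_pos by (auto simp: K_def)
      have "(\<Sum>v\<in>K i. a v) = (\<Sum>v\<in>K i. 1 / real (D i))"
        by (intro sum.cong) (auto simp: a_def K_def)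
      then have "(\<Sum>v\<in>K i. a v) = real (card (H i)) / real (D i)"
        by (simp add: cK)
      moreover have "real k * real (D i) \<le> real (card (H i))"
        using assms(7)[OF i] unfolding D_def by (simp flip: of_nat_mult)
      ultimately show ?thesis using D by (simp add: pos_le_divide_eq)
    qed
  qed simp
  then obtain S where S: "disjoint_family_on E S" and meet: "\<forall>i\<in>{1..m}. \<exists>v. v \<in> S \<inter> K i"
    by blast
  \<comment> \<open>\<open>S\<close> may meet a class more than once, so one vertex per colour is
    chosen. Distinct colours give distinct vertices and hence disjoint edges.\<close>
  obtain s where s: "\<And>i. i \<in> {1..m} \<Longrightarrow> s i \<in> S \<inter> K i"
    using bchoice[OF meet] by blast
  define f where "f i = E (s i)" for i
  have fH: "f i \<in> H i" if "i \<in> {1..m}" for i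
    using s[OF that] hW(2)[of "s i"] by (auto simp: f_def K_def)
  have "f i \<inter> f j = {}" if "i \<in> {1..m}" "j \<in> {1..m}" "i \<noteq> j" for i j
  proof -
    have "s i \<noteq> s j" using s[OF that(1)] s[OF that(2)] that(3) by (auto simp: K_def)
    then show ?thesis
      using S s[OF that(1)] s[OF that(2)] by (auto simp: disjoint_family_on_def f_def)
  qed
  with fH have "is_SJR m H f" unfolding is_SJR_def by blast
  then show ?thesis by blast
qed

end
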